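(* There is a Hausdorff topological space $X$ such that player two has a winning strategy in the game $G^\omega_{fin}(\mathcal{O}_X,\mathcal{D}_X)$, but no dense subset of $X$ is the union of countably many $H$-closed subspaces.
   Context: For an ordinal $\alpha$ and collections of sets $\mathcal{A},\mathcal{B}$, $G^\alpha_{fin}(\mathcal{A},\mathcal{B})$ denotes the two-player game of length $\alpha$ in which, at inning $\beta<\alpha$, player one chooses $\mathcal{U}_\beta\in\mathcal{A}$ and player two responds with a finite set $\mathcal{V}_\beta\subseteq\mathcal{U}_\beta$. Player two wins if and only if $\bigcup\{\mathcal{V}_\beta:\beta<\alpha\}\in\mathcal{B}$. For a topological space $X$: $\mathcal{O}_X$ is the set of all open covers of $X$, and $\mathcal{D}_X$ is the collection of all families $\mathcal{U}$ of open subsets of $X$ such that $\bigcup\mathcal{U}$ is dense in $X$. A space is $H$-closed if every open cover of it has a finite subfamily whose union is dense in it; a subspace is $H$-closed if it is $H$-closed in its subspace topology. *)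

theory Defs
  imports "HOL-Analysis.Analysis"
begin

definition dense_subset :: "'a topology \<Rightarrow> 'a set \<Rightarrow> bool" where
  "dense_subset X S \<longleftrightarrow> S \<subseteq> topspace X \<and> X closure_of S = topspace X"

definition open_covers :: "'a topology \<Rightarrow> 'a set set set" where
  "open_covers X = {\<U>. (\<forall>U\<in>\<U>. openin X U) \<and> \<Union>\<U> = topspace X}"

definition dense_open_families :: "'a topology \<Rightarrow> 'a set set set" where
  "dense_open_families X = {\<U>. (\<forall>U\<in>\<U>. openin X U) \<and> dense_subset X (\<Union>\<U>)}"

(* As in the usual covering formulation, no separation axiom is built in. *)
definition H_closed_space :: "'a topology \<Rightarrow> bool" where
  "H_closed_space X \<longleftrightarrow>
     (\<forall>\<U>\<in>open_covers X. \<exists>\<F>. finite \<F> \<and> \<F> \<subseteq> \<U> \<and> dense_subset X (\<Union>\<F>))"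

definition H_closed_in :: "'a topology \<Rightarrow> 'a set \<Rightarrow> bool" where
  "H_closed_in X S \<longleftrightarrow> S \<subseteq> topspace X \<and> H_closed_space (subtopology X S)"

(* Strategies for player two in the game of length omega: the reply in inning n is computed
   from the list of player one's moves in innings 0, ..., n, in order. Player two's own
   earlier moves are determined by these, so they are not passed as a separate argument. *)
type_synonym 'a strategy = "'a set list \<Rightarrow> 'a set"

definition reply :: "'a strategy \<Rightarrow> (nat \<Rightarrow> 'a set) \<Rightarrow> nat \<Rightarrow> 'a set" where
  "reply \<sigma> \<U> n = \<sigma> (map \<U> [0..<Suc n])"

definition Gfin_omega_winning_strategy ::
    "'a set set \<Rightarrow> 'a set set \<Rightarrow> 'a strategy \<Rightarrow> bool" where
  "Gfin_omega_winning_strategy \<A> \<B> \<sigma> \<longleftrightarrow>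
     (\<forall>\<U>. (\<forall>n. \<U> n \<in> \<A>) \<longrightarrow>
        (\<forall>n. finite (reply \<sigma> \<U> n) \<and> reply \<sigma> \<U> n \<subseteq> \<U> n) \<and> (\<Union>n. reply \<sigma> \<U> n) \<in> \<B>)"

definition player_two_wins_Gfin_omega :: "'a set set \<Rightarrow> 'a set set \<Rightarrow> bool" where
  "player_two_wins_Gfin_omega \<A> \<B> \<longleftrightarrow> (\<exists>\<sigma>. Gfin_omega_winning_strategy \<A> \<B> \<sigma>)"

(* HOL cannot quantify existentially over types, so an existence claim about topological
   spaces has to name a type for the points. A term of type "real topology" is an arbitrary
   topology on an arbitrary set of reals (topspace X), unrelated to the Euclidean one; up to
   homeomorphism these are all spaces of cardinality at most the continuum. *)

end

theory Submission
  imports Defs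
begin

text \<open>
  The witness is the one-point Lindelof extension of an uncountable discrete space: every real
  other than \<open>0\<close> is isolated, and the neighbourhoods of \<open>0\<close> are the co-countable sets around it.

  A single open set containing \<open>0\<close> leaves only countably many points uncovered, so player two
  takes such a set in the first inning and spends the remaining innings catching the leftover
  points one at a time. The resulting selection even covers the space.

  On the other hand, a countable set of isolated points is closed and discrete. An infinite
  \<open>H\<close>-closed subspace would contain an infinite such set as a clopen piece, and the cover by its
  singletons together with the rest of the subspace has no finite subfamily with dense union.
  So \<open>H\<close>-closed subspaces are finite, countable unions of them are countable, and these
  cannot be dense because a dense set contains all of the uncountably many isolated points.
\<close>

definition cocountable_at :: "'a \<Rightarrow> 'a topology" where
  "cocountable_at p = topology (\<lambda>U. p \<in> U \<longrightarrow> countable (- U))"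

lemma openin_cocountable_at [simp]:
  "openin (cocountable_at p) U \<longleftrightarrow> (p \<in> U \<longrightarrow> countable (- U))"
proof -
  have "istopology (\<lambda>U. p \<in> U \<longrightarrow> countable (- U))"
    unfolding istopology_def
  proof (intro conjI allI impI)
    fix S T :: "'a set"
    assume "p \<in> S \<longrightarrow> countable (- S)" "p \<in> T \<longrightarrow> countable (- T)" "p \<in> S \<inter> T"
    then show "countable (- (S \<inter> T))" by simp
  next
    fix \<K> :: "'a set set"
    assume K: "\<forall>S\<in>\<K>. p \<in> S \<longrightarrow> countable (- S)" and "p \<in> \<Union>\<K>"
    then obtain S where "S \<in> \<K>" "countable (- S)" by blast
    then show "countable (- \<Union>\<K>)" by (blast intro: countable_subset)
  qed
  then show ?thesis by (simp add: cocountable_at_def topology_inverse')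
qed

lemma topspace_cocountable_at [simp]: "topspace (cocountable_at p) = UNIV"
proof -
  have "openin (cocountable_at p) UNIV" by simp
  then show ?thesis using openin_subset by blast
qed

lemma Hausdorff_cocountable_at: "Hausdorff_space (cocountable_at p)"
  unfolding Hausdorff_space_def
proof (intro allI impI)
  fix x y :: 'a
  assume "x \<in> topspace (cocountable_at p) \<and> y \<in> topspace (cocountable_at p) \<and> x \<noteq> y"
  then have "x \<noteq> y" by simp
  show "\<exists>U V. openin (cocountable_at p) U \<and> openin (cocountable_at p) V
              \<and> x \<in> U \<and> y \<in> V \<and> disjnt U V"
  proof (cases "x = p")
    case True
    with \<open>x \<noteq> y\<close> show ?thesis
      by (intro exI[of _ "- {y}"] exI[of _ "{y}"]) (auto simp: disjnt_def)
  next
    case False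
    with \<open>x \<noteq> y\<close> show ?thesis
      by (intro exI[of _ "{x}"] exI[of _ "- {x}"]) (auto simp: disjnt_def)
  qed
qed

text \<open>
  Only the first cover determines which countable remainder has to be enumerated, and a strategy
  sees it as the head of the history. Choosing the member around \<open>p\<close> in every inning, not just in
  the first, keeps each reply inside the current cover with one uniform formula.
\<close>
lemma player_two_wins_cocountable_at:
  fixes p :: 'a
  shows "player_two_wins_Gfin_omega (open_covers (cocountable_at p))
           (dense_open_families (cocountable_at p))"
proof -
  let ?X = "cocountable_at p"
  define pick :: "'a set set \<Rightarrow> 'a \<Rightarrow> 'a set"
    where "pick \<U> x = (SOME U. U \<in> \<U> \<and> x \<in> U)" for \<U> x
  define \<sigma> :: "'a set strategy"
    where "\<sigma> L = {pick (last L) p,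
                  pick (last L) (from_nat_into (- pick (hd L) p) (length L - 1))}" for L
  have pick: "pick \<U> x \<in> \<U> \<and> x \<in> pick \<U> x" if "\<U> \<in> open_covers ?X" for \<U> x
  proof -
    have "\<exists>U. U \<in> \<U> \<and> x \<in> U" using that unfolding open_covers_def by auto
    then show ?thesis unfolding pick_def by (rule someI_ex)
  qed
  have "Gfin_omega_winning_strategy (open_covers ?X) (dense_open_families ?X) \<sigma>"
    unfolding Gfin_omega_winning_strategy_def
  proof (intro allI impI)
    fix \<U> :: "nat \<Rightarrow> 'a set set"
    assume covers: "\<forall>n. \<U> n \<in> open_covers ?X"
    define R where "R = - pick (\<U> 0) p"
    have reply: "reply \<sigma> \<U> n = {pick (\<U> n) p, pick (\<U> n) (from_nat_into R n)}" for n
    proof -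
      have "hd (map \<U> [0..<Suc n]) = \<U> 0"
        by (subst upt_conv_Cons) auto
      then show ?thesis by (simp add: reply_def \<sigma>_def R_def)
    qed
    have legal: "finite (reply \<sigma> \<U> n) \<and> reply \<sigma> \<U> n \<subseteq> \<U> n" for n
      using pick covers by (simp add: reply)
    have "openin ?X (pick (\<U> 0) p)"
      using pick[of "\<U> 0" p] covers unfolding open_covers_def by blast
    then have "countable R"
      using pick[of "\<U> 0" p] covers by (simp add: R_def)
    have "x \<in> \<Union>(\<Union>n. reply \<sigma> \<U> n)" for x
    proof (cases "x \<in> R")
      case True
      then obtain n where "from_nat_into R n = x"
        using from_nat_into_surj[OF \<open>countable R\<close>] by blast
      then have "x \<in> pick (\<U> n) (from_nat_into R n)" using pick covers by blast
      then show ?thesis by (auto simp: reply)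
    next
      case False
      then have "x \<in> pick (\<U> 0) p" by (simp add: R_def)
      then show ?thesis by (auto simp: reply)
    qed
    then have cover: "\<Union>(\<Union>n. reply \<sigma> \<U> n) = topspace ?X"
      unfolding topspace_cocountable_at by blast
    have "\<forall>U\<in>(\<Union>n. reply \<sigma> \<U> n). openin ?X U"
      using legal covers unfolding open_covers_def by blast
    moreover have "dense_subset ?X (\<Union>(\<Union>n. reply \<sigma> \<U> n))"
      unfolding cover dense_subset_def by (simp del: topspace_cocountable_at)
    ultimately have "(\<Union>n. reply \<sigma> \<U> n) \<in> dense_open_families ?X"
      unfolding dense_open_families_def by blast
    with legal show "(\<forall>n. finite (reply \<sigma> \<U> n) \<and> reply \<sigma> \<U> n \<subseteq> \<U> n)
        \<and> (\<Union>n. reply \<sigma> \<U> n) \<in> dense_open_families ?X" by blast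
  qed
  then show ?thesis unfolding player_two_wins_Gfin_omega_def by blast
qed

lemma dense_subset_contains_open_point:
  assumes "dense_subset X D" "openin X {x}"
  shows "x \<in> D"
proof -
  have "x \<in> X closure_of D"
    using assms openin_subset[of X "{x}"] unfolding dense_subset_def by auto
  then show ?thesis using assms(2) unfolding in_closure_of by blast
qed

text \<open>
  Every infinite set contains a countably infinite set of points other than \<open>p\<close>. Being countable
  it can be removed from the subspace without spoiling openness at \<open>p\<close>, which makes it an
  infinite clopen discrete piece.
\<close>
lemma H_closed_in_cocountable_at_finite:
  assumes "H_closed_in (cocountable_at p) H"
  shows "finite H"
proof (rule ccontr)
  let ?Y = "subtopology (cocountable_at p) H"
  assume "infinite H"
  then have "infinite (H - {p})" by simp
  then obtain A where A: "A \<subseteq> H - {p}" "infinite A" "countable A"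
    using infinite_countable_subset' by blast
  let ?\<U> = "insert (H - A) ((\<lambda>a. {a}) ` A)"
  have point: "openin ?Y {a}" if "a \<in> A" for a
    using that A(1) unfolding openin_subtopology by (intro exI[of _ "{a}"]) auto
  have rest: "openin ?Y (H - A)"
    using A unfolding openin_subtopology by (intro exI[of _ "- A"]) auto
  have "?\<U> \<in> open_covers ?Y"
    using point rest A(1) unfolding open_covers_def by auto
  then obtain \<F> where \<F>: "finite \<F>" "\<F> \<subseteq> ?\<U>" "dense_subset ?Y (\<Union>\<F>)"
    using assms unfolding H_closed_in_def H_closed_space_def by blast
  have "(\<lambda>a. {a}) ` A \<subseteq> \<F>"
  proof clarify
    fix a assume "a \<in> A"
    then have "a \<in> \<Union>\<F>"
      using dense_subset_contains_open_point[OF \<F>(3)] point by blast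
    then show "{a} \<in> \<F>" using \<F>(2) \<open>a \<in> A\<close> by auto
  qed
  then have "finite ((\<lambda>a. {a}) ` A)" using \<F>(1) finite_subset by blast
  then show False using A(2) by (simp add: finite_image_iff)
qed

theorem mainTheorem3:
  shows "\<exists>X :: real topology.
    Hausdorff_space X \<and>
    player_two_wins_Gfin_omega (open_covers X) (dense_open_families X) \<and>
    \<not> (\<exists>S. dense_subset X S \<and>
          (\<exists>\<H>. countable \<H> \<and> (\<forall>H\<in>\<H>. H_closed_in X H) \<and> S = \<Union>\<H>))"
proof (intro exI[of _ "cocountable_at 0"] conjI notI)
  show "Hausdorff_space (cocountable_at (0::real))"
    by (rule Hausdorff_cocountable_at)
  show "player_two_wins_Gfin_omega (open_covers (cocountable_at (0::real)))
          (dense_open_families (cocountable_at 0))"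
    by (rule player_two_wins_cocountable_at)
  assume "\<exists>S. dense_subset (cocountable_at (0::real)) S \<and>
    (\<exists>\<H>. countable \<H> \<and> (\<forall>H\<in>\<H>. H_closed_in (cocountable_at 0) H) \<and> S = \<Union>\<H>)"
  then obtain \<H> where \<H>: "dense_subset (cocountable_at (0::real)) (\<Union>\<H>)" "countable \<H>"
      "\<And>H. H \<in> \<H> \<Longrightarrow> H_closed_in (cocountable_at 0) H" by blast
  have "countable (\<Union>H\<in>\<H>. H)"
    using countable_finite[OF H_closed_in_cocountable_at_finite[OF \<H>(3)]]
    by (intro countable_UN \<H>(2))
  then have "countable (\<Union>\<H>)" by simp
  moreover have "UNIV \<subseteq> insert 0 (\<Union>\<H>)"
    using dense_subset_contains_open_point[OF \<H>(1)] by auto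
  ultimately have "countable (UNIV :: real set)"
    by (meson countable_insert countable_subset)
  then show False using uncountable_UNIV_real by blast
qed

end
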